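(* Let $\gamma\in(0,1)$ and let $\rho(w,t)$ be a solution of the modified Yard-Sale Model equation $$\frac{\partial \rho(w,t)}{\partial t}=\frac{\partial^2}{\partial w^2}\Big[D[w,\rho(\cdot,t)]\,\rho(w,t)\Big],\qquad D[w,\rho(\cdot,t)]:=\frac{\gamma}{2}\int_0^\infty \kappa(w,x)\rho(x,t)\,dx,$$ where $\kappa(w,x)=(w\wedge x)^2$ if $w\wedge x<1$ and $\kappa(w,x)=w\wedge x$ if $w\wedge x\ge 1$. Let $$G(t):=1-\int_0^\infty\int_0^\infty (w\wedge x)\,\rho(w,t)\rho(x,t)\,dx\,dw$$ be its Gini coefficient. If the initial datum $\rho_0(w)=\rho(w,0)$ is in $L^\infty(\mathbb{R}^+)$ and the dynamics keep $\rho(\cdot,t)$ in $L^\infty(\mathbb{R}^+)$ up to time $s>0$, then $$\frac{dG}{dt}\le \gamma\,\|\rho(\cdot,t)\|_\infty\,\big(1-G(t)\big)\qquad\text{for } 0<t<s.$$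
   Context: Here $w\wedge x:=\min(w,x)$, $\mathbb{R}^+$ is the positive half-line, and $\|\cdot\|_\infty$ is the $L^\infty(\mathbb{R}^+)$ norm. For each $t$, $\rho(\cdot,t)$ is a probability density on $\mathbb{R}^+$ (the distribution of agents in dimensionless wealth $w$, all wealths positive) normalized to have unit zeroth and first moments: $\int_0^\infty\rho(w,t)\,dw=1$ and $\int_0^\infty w\,\rho(w,t)\,dw=1$; both moments are conserved by the dynamics. *)

theory Defs
  imports "HOL-Analysis.Analysis" "HOL-Probability.Essential_Supremum"
begin

abbreviation half_line :: "real measure"
  where "half_line \<equiv> restrict_space lborel {0<..}"

text \<open>Probability densities on the half-line with unit first moment.\<close>

definition wealth_density :: "(real \<Rightarrow> real) \<Rightarrow> bool"
  where "wealth_density f \<longleftrightarrow>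
    (AE w in half_line. 0 \<le> f w) \<and>
    has_bochner_integral half_line f 1 \<and>
    has_bochner_integral half_line (\<lambda>w. w * f w) 1"

text \<open>The norm takes extended real values: \<open>f\<close> is in the space \<open>L\<close>-infinity iff its norm is
  less than \<open>\<infinity>\<close>. In particular \<open>esssup\<close> is \<open>\<infinity>\<close> for functions that are not measurable.\<close>

definition Linf_norm :: "(real \<Rightarrow> real) \<Rightarrow> ereal"
  where "Linf_norm f = esssup half_line (\<lambda>w. ereal \<bar>f w\<bar>)"

definition kappa :: "real \<Rightarrow> real \<Rightarrow> real"
  where "kappa w x = (if min w x < 1 then (min w x)\<^sup>2 else min w x)"

definition diffusion :: "real \<Rightarrow> (real \<Rightarrow> real) \<Rightarrow> real \<Rightarrow> real"
  where "diffusion \<gamma> f w = \<gamma> / 2 * (\<integral>x. kappa w x * f x \<partial>half_line)"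

definition gini :: "(real \<Rightarrow> real) \<Rightarrow> real"
  where "gini f = 1 - (\<integral>w. (\<integral>x. min w x * f w * f x \<partial>half_line) \<partial>half_line)"

text \<open>Classical solutions on the time interval \<open>[0, s)\<close>; the density at wealth \<open>w\<close> and time \<open>t\<close> is
  \<open>\<rho> w t\<close>. The function \<open>\<rho>\<^sub>t\<close> is the time derivative of \<open>\<rho>\<close>, and \<open>J\<close> is the first \<open>w\<close>-derivative
  of the product of diffusion coefficient and density, so the last two derivative conditions say
  that the second \<open>w\<close>-derivative of this product exists and equals \<open>\<rho>\<^sub>t\<close>. Only the product is
  differentiated in \<open>w\<close>, since the kink of \<open>kappa\<close> makes the coefficient in general
  non-differentiable at \<open>w = 1\<close>. No boundary conditions are imposed at \<open>0\<close> and \<open>\<infinity>\<close>; conservation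
  of the two moments takes their place. The initial datum \<open>\<lambda>w. \<rho> w 0\<close> is attained in the
  sense of weak convergence of probability measures.\<close>

definition yard_sale_solution :: "real \<Rightarrow> real \<Rightarrow> (real \<Rightarrow> real \<Rightarrow> real) \<Rightarrow> bool"
  where "yard_sale_solution \<gamma> s \<rho> \<longleftrightarrow>
    (\<forall>t\<in>{0..<s}. wealth_density (\<lambda>w. \<rho> w t)) \<and>
    (\<exists>\<rho>\<^sub>t J.
      continuous_on ({0<..} \<times> {0<..<s}) (\<lambda>(w, t). \<rho>\<^sub>t w t) \<and>
      (\<forall>w>0. \<forall>t\<in>{0<..<s}.
        ((\<lambda>\<tau>. \<rho> w \<tau>) has_real_derivative \<rho>\<^sub>t w t) (at t) \<and>
        ((\<lambda>v. diffusion \<gamma> (\<lambda>x. \<rho> x t) v * \<rho> v t) has_real_derivative J w t) (at w) \<and>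
        ((\<lambda>v. J v t) has_real_derivative \<rho>\<^sub>t w t) (at w))) \<and>
    (\<forall>\<phi> :: real \<Rightarrow> real. continuous_on {0<..} \<phi> \<and> bounded (\<phi> ` {0<..}) \<longrightarrow>
      ((\<lambda>t. \<integral>w. \<phi> w * \<rho> w t \<partial>half_line) \<longlongrightarrow> (\<integral>w. \<phi> w * \<rho> w 0 \<partial>half_line)) (at_right 0))"

end

theory Submission
  imports Defs
begin

text \<open>Write \<open>M w t\<close> for the integral of \<open>min w x\<close> against \<open>\<rho> x t\<close> and \<open>P\<close> for the product of
  diffusion coefficient and density, so that \<open>1 - G\<close> is the integral of \<open>M \<rho>\<close>. Since the second
  \<open>w\<close>-derivative of \<open>M\<close> is \<open>- \<rho>\<close>, the equation says that the time derivative of \<open>M\<close> and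
  \<open>- P\<close> differ by an affine function of \<open>w\<close>. The moments and the bound on \<open>\<rho>\<close> control both \<open>M\<close>
  and \<open>P\<close> by a multiple of \<open>min w 1\<close>, so this affine function vanishes. By symmetry of \<open>min\<close> the
  Gini coefficient therefore has derivative \<open>2 \<integral> P \<rho>\<close>, and \<open>kappa \<le> min\<close> bounds \<open>P\<close> by
  \<open>\<gamma> / 2\<close> times the norm of \<open>\<rho>\<close> times \<open>M\<close>. No decay of the time derivative of \<open>\<rho>\<close> is
  available, so the first step is carried out with second differences in \<open>w\<close>, whose kernel has
  compact support, and the passage to the limit in \<open>G\<close> with Scheffe's lemma.\<close>

section \<open>Second differences in the wealth variable\<close>

text \<open>Along the multiples of a point \<open>v\<close>, vanishing second differences make
  \<open>H\<close> an arithmetic progression, and boundedness forces its common difference to be 0.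
  So \<open>H\<close> is invariant under doubling, hence under halving, and the linear bound near 0
  gives the value 0. This is the tool that excludes the affine function of \<open>w\<close>.\<close>

lemma eq_0_if_second_differences_0:
  fixes H :: "real \<Rightarrow> real"
  assumes diff: "\<And>w h. 0 < h \<Longrightarrow> h < w \<Longrightarrow> H (w + h) - 2 * H w + H (w - h) = 0"
    and bounded: "\<And>w. 0 < w \<Longrightarrow> \<bar>H w\<bar> \<le> C"
    and small: "\<And>w. 0 < w \<Longrightarrow> \<bar>H w\<bar> \<le> C * w"
    and "0 < w"
  shows "H w = 0"
proof -
  have double: "H (2 * v) = H v" if "0 < v" for v
  proof (rule ccontr)
    assume neq: "H (2 * v) \<noteq> H v"
    \<comment> \<open>The progression starts at \<open>v\<close> because 0 lies outside the
      half-line. Two consecutive values are carried along, as the recurrence has three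
      terms.\<close>
    have progression: "H (real (Suc n) * v) = H v + real n * (H (2 * v) - H v) \<and>
        H (real (Suc (Suc n)) * v) = H v + real (Suc n) * (H (2 * v) - H v)" for n
    proof (induction n)
      case (Suc n)
      have "H (real (Suc (Suc n)) * v + v) - 2 * H (real (Suc (Suc n)) * v)
          + H (real (Suc (Suc n)) * v - v) = 0"
        using that by (intro diff) (auto simp: algebra_simps add_pos_nonneg)
      moreover have "real (Suc (Suc n)) * v + v = real (Suc (Suc (Suc n))) * v"
        "real (Suc (Suc n)) * v - v = real (Suc n) * v"
        by (auto simp: algebra_simps)
      ultimately show ?case
        using Suc by (simp add: algebra_simps)
    qed simp
    obtain n where "2 * C < real n * \<bar>H (2 * v) - H v\<bar>"
      using reals_Archimedean3[of "\<bar>H (2 * v) - H v\<bar>"] neq by auto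
    also have "\<dots> = \<bar>H (real (Suc n) * v) - H v\<bar>"
      using progression[of n] by (simp add: abs_mult)
    also have "\<dots> \<le> 2 * C"
      using bounded[of "real (Suc n) * v"] bounded[of v] that by auto
    finally show False by simp
  qed
  have halves: "H (w / 2 ^ n) = H w" for n
  proof (induction n)
    case (Suc n)
    then show ?case
      using double[of "w / 2 ^ Suc n"] \<open>0 < w\<close> by simp
  qed simp
  have "(\<lambda>n. C * w * (1 / 2) ^ n) \<longlonglongrightarrow> C * w * 0"
    by (intro tendsto_intros) auto
  moreover have "\<bar>H w\<bar> \<le> C * w * (1 / 2) ^ n" for n
    using small[of "w / 2 ^ n"] halves[of n] \<open>0 < w\<close> by (simp add: power_divide)
  ultimately have "\<bar>H w\<bar> \<le> 0"
    by (intro LIMSEQ_le_const[of "\<lambda>n. C * w * (1 / 2) ^ n"]) auto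
  then show ?thesis by simp
qed

text \<open>The kink of \<open>min\<close> at \<open>w = x\<close> turns into a tent of half-width
  \<open>h\<close>: the discrete form of the second \<open>w\<close>-derivative being minus the
  Dirac mass at \<open>x\<close>.\<close>

lemma second_difference_min:
  fixes w x h :: real
  assumes "0 \<le> h"
  shows "min (w + h) x - 2 * min w x + min (w - h) x = - max 0 (h - \<bar>x - w\<bar>)"
  using assms by (auto simp: min_def max_def abs_if)

text \<open>Peano kernel of the second difference.\<close>

lemma has_integral_second_difference:
  fixes P J p :: "real \<Rightarrow> real"
  assumes "0 < h"
    and P: "\<And>x. x \<in> {w - h..w + h} \<Longrightarrow> (P has_real_derivative J x) (at x)"
    and J: "\<And>x. x \<in> {w - h..w + h} \<Longrightarrow> (J has_real_derivative p x) (at x)"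
  shows "((\<lambda>x. (h - \<bar>x - w\<bar>) * p x) has_integral P (w + h) - 2 * P w + P (w - h)) {w - h..w + h}"
proof -
  \<comment> \<open>The tent is affine on each side of \<open>w\<close>, and integration by parts
    yields this antiderivative. When the two halves are joined, the terms \<open>h * J w\<close>
    cancel.\<close>
  have "((\<lambda>x. (h - w + x) * J x - P x) has_real_derivative (h - \<bar>x - w\<bar>) * p x) (at x)"
    if "x \<in> {w - h..w}" for x
    using that \<open>0 < h\<close> by (auto intro!: derivative_eq_intros P J)
  then have left: "((\<lambda>x. (h - \<bar>x - w\<bar>) * p x) has_integral
      (((h - w + w) * J w - P w) - ((h - w + (w - h)) * J (w - h) - P (w - h)))) {w - h..w}"
    using \<open>0 < h\<close> by (intro fundamental_theorem_of_calculus)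
      (auto simp: has_real_derivative_iff_has_vector_derivative[symmetric] intro: has_field_derivative_at_within)
  have "((\<lambda>x. (h + w - x) * J x + P x) has_real_derivative (h - \<bar>x - w\<bar>) * p x) (at x)"
    if "x \<in> {w..w + h}" for x
    using that \<open>0 < h\<close> by (auto intro!: derivative_eq_intros P J)
  then have right: "((\<lambda>x. (h - \<bar>x - w\<bar>) * p x) has_integral
      (((h + w - (w + h)) * J (w + h) + P (w + h)) - ((h + w - w) * J w + P w))) {w..w + h}"
    using \<open>0 < h\<close> by (intro fundamental_theorem_of_calculus)
      (auto simp: has_real_derivative_iff_has_vector_derivative[symmetric] intro: has_field_derivative_at_within)
  show ?thesis
    using has_integral_combine[OF _ _ left right] \<open>0 < h\<close> by (simp add: algebra_simps)
qed

section \<open>Integration on the half-line\<close>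

text \<open>The set where \<open>f\<close> exceeds \<open>K\<close> is open and null, hence empty.
  Essential bounds on continuous densities thereby become pointwise.\<close>

lemma AE_lborel_le_imp_le:
  fixes f :: "real \<Rightarrow> real"
  assumes ae: "AE x in restrict_space lborel S. f x \<le> K"
    and "open S" and cont: "continuous_on S f" and "x \<in> S"
  shows "f x \<le> K"
proof -
  have "open {x \<in> S. K < f x}"
    using continuous_on_open_vimage[OF \<open>open S\<close>, of f] cont
    by (auto simp: vimage_def Int_def conj_commute dest!: spec[of _ "{K<..}"])
  moreover have "AE x\<in>S in lebesgue. x \<in> - {x \<in> S. K < f x}"
    using ae \<open>open S\<close>
    by (intro AE_completion) (auto simp: AE_restrict_space_iff elim!: eventually_mono)
  ultimately show ?thesis
    using mem_closed_if_AE_lebesgue_open[OF \<open>open S\<close>, of "- {x \<in> S. K < f x}" x] \<open>x \<in> S\<close>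
    by (auto simp: not_less)
qed

lemma sigma_finite_half_line: "sigma_finite_measure half_line"
  by (intro sigma_finite_measure_restrict_space) (auto simp: sigma_finite_lborel)

lemma AE_half_lineI: "(\<And>x. 0 < x \<Longrightarrow> Q x) \<Longrightarrow> AE x in half_line. Q x"
  by (rule AE_I2) (simp add: space_restrict_space)

lemma wealth_densityD:
  assumes "wealth_density f"
  shows "AE x in half_line. 0 \<le> f x" "integrable half_line f" "integrable half_line (\<lambda>x. x * f x)"
    "(\<integral>x. f x \<partial>half_line) = 1" "(\<integral>x. x * f x \<partial>half_line) = 1"
    "f \<in> borel_measurable half_line"
  using assms unfolding wealth_density_def has_bochner_integral_iff by auto

lemma measurable_half_line: "g \<in> borel_measurable borel \<Longrightarrow> g \<in> borel_measurable half_line"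
  by (intro measurable_restrict_space1) simp

lemma integrable_bounded_mult:
  fixes f g :: "'a \<Rightarrow> real"
  assumes "integrable M f" "g \<in> borel_measurable M" "AE x in M. \<bar>g x\<bar> \<le> C"
  shows "integrable M (\<lambda>x. g x * f x)"
proof (rule Bochner_Integration.integrable_bound)
  show "integrable M (\<lambda>x. C * f x)" using assms by simp
  show "(\<lambda>x. g x * f x) \<in> borel_measurable M" using assms by measurable
  show "AE x in M. norm (g x * f x) \<le> norm (C * f x)"
    using assms(3) by eventually_elim (auto simp: abs_mult intro!: mult_right_mono)
qed

text \<open>All masses being 1, Scheffe's lemma upgrades pointwise convergence of the densities to
  L1 convergence, without a common majorant. In the splitting
  \<open>q n * (f n - f') + q n * f'\<close> the first part then tends to 0 since \<open>q n\<close>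
  is uniformly bounded, and the second converges by dominated convergence.\<close>

lemma tendsto_integral_mult_density:
  fixes q :: "nat \<Rightarrow> real \<Rightarrow> real"
  assumes f: "\<And>n. wealth_density (f n)" "wealth_density f'"
    and lim: "\<And>x. 0 < x \<Longrightarrow> (\<lambda>n. f n x) \<longlonglongrightarrow> f' x"
    and q: "\<And>n. q n \<in> borel_measurable half_line" "\<And>n x. 0 < x \<Longrightarrow> \<bar>q n x\<bar> \<le> C"
    and limq: "\<And>x. 0 < x \<Longrightarrow> (\<lambda>n. q n x) \<longlonglongrightarrow> q' x"
  shows "(\<lambda>n. \<integral>x. q n x * f n x \<partial>half_line) \<longlonglongrightarrow> (\<integral>x. q' x * f' x \<partial>half_line)"
proof -
  note f1 = wealth_densityD[OF f(1)] and f2 = wealth_densityD[OF f(2)]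
  \<comment> \<open>Equality of these norms supplies the norm comparison in Scheffe's lemma.\<close>
  have norm1: "(\<integral>\<^sup>+x. norm (g x) \<partial>half_line) = 1" if "wealth_density g" for g
  proof -
    note g = wealth_densityD[OF that]
    have "(\<integral>\<^sup>+x. norm (g x) \<partial>half_line) = ennreal (\<integral>x. norm (g x) \<partial>half_line)"
      using g by (intro nn_integral_eq_integral) auto
    also have "(\<integral>x. norm (g x) \<partial>half_line) = (\<integral>x. g x \<partial>half_line)"
      using g by (intro integral_cong_AE) (auto elim!: eventually_mono)
    finally show ?thesis using g by simp
  qed
  have "(\<lambda>n. \<integral>\<^sup>+x. norm (f n x - f' x) \<partial>half_line) \<longlonglongrightarrow> 0"
    using f1 f2 norm1[OF f(1)] norm1[OF f(2)] AE_half_lineI[OF lim]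
    by (intro Scheffe_lemma2) simp_all
  also have "(\<lambda>n. \<integral>\<^sup>+x. norm (f n x - f' x) \<partial>half_line) =
      (\<lambda>n. ennreal (\<integral>x. norm (f n x - f' x) \<partial>half_line))"
    using f1 f2 by (intro ext nn_integral_eq_integral) auto
  finally have L1: "(\<lambda>n. \<integral>x. norm (f n x - f' x) \<partial>half_line) \<longlonglongrightarrow> 0"
    by (subst (asm) ennreal_0[symmetric], subst (asm) tendsto_ennreal_iff) auto
  have q_ae: "AE x in half_line. \<bar>q n x\<bar> \<le> C" for n
    by (intro AE_half_lineI q)
  note int[simp] = integrable_bounded_mult[OF f1(2) q(1) q_ae] integrable_bounded_mult[OF f2(2) q(1) q_ae]
  have "(\<lambda>n. \<integral>x. q n x * (f n x - f' x) \<partial>half_line) \<longlonglongrightarrow> 0"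
  proof (rule Lim_null_comparison)
    show "\<forall>\<^sub>F n in sequentially. norm (\<integral>x. q n x * (f n x - f' x) \<partial>half_line)
        \<le> C * (\<integral>x. norm (f n x - f' x) \<partial>half_line)"
    proof (intro always_eventually allI)
      fix n
      have "AE x in half_line. norm (q n x * (f n x - f' x)) \<le> C * norm (f n x - f' x)"
        using q_ae[of n] by eventually_elim (auto simp: abs_mult intro: mult_right_mono)
      then have "norm (\<integral>x. q n x * (f n x - f' x) \<partial>half_line) \<le> (\<integral>x. C * norm (f n x - f' x) \<partial>half_line)"
        using f1(2) f2(2) q_ae[of n]
        by (intro order_trans[OF integral_norm_bound integral_mono_AE]
            integrable_norm integrable_bounded_mult[where C = C] q) auto
      then show "norm (\<integral>x. q n x * (f n x - f' x) \<partial>half_line)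
        \<le> C * (\<integral>x. norm (f n x - f' x) \<partial>half_line)" by simp
    qed
    show "(\<lambda>n. C * (\<integral>x. norm (f n x - f' x) \<partial>half_line)) \<longlonglongrightarrow> 0"
      using tendsto_mult[OF tendsto_const L1, of C] by simp
  qed
  moreover have "(\<lambda>n. \<integral>x. q n x * f' x \<partial>half_line) \<longlonglongrightarrow> (\<integral>x. q' x * f' x \<partial>half_line)"
  proof (rule integral_dominated_convergence[where w = "\<lambda>x. C * \<bar>f' x\<bar>"])
    show "AE x in half_line. (\<lambda>n. q n x * f' x) \<longlonglongrightarrow> q' x * f' x"
      by (intro AE_half_lineI tendsto_intros limq)
    have "q' \<in> borel_measurable half_line"
      using limq by (intro borel_measurable_LIMSEQ_real[OF _ q(1)]) (auto simp: space_restrict_space)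
    then show "(\<lambda>x. q' x * f' x) \<in> borel_measurable half_line" using f2 by simp
    show "AE x in half_line. norm (q n x * f' x) \<le> C * \<bar>f' x\<bar>" for n
      using q_ae[of n] by eventually_elim (auto simp: abs_mult intro!: mult_right_mono)
  qed (use f2 q in auto)
  ultimately have "(\<lambda>n. (\<integral>x. q n x * (f n x - f' x) \<partial>half_line) + (\<integral>x. q n x * f' x \<partial>half_line))
      \<longlonglongrightarrow> 0 + (\<integral>x. q' x * f' x \<partial>half_line)"
    by (rule tendsto_add)
  then show ?thesis
    by (simp add: right_diff_distrib)
qed

lemma measurable_ident_half_line [measurable]: "(\<lambda>x. x) \<in> borel_measurable half_line"
  by (rule measurable_half_line) simp

section \<open>The truncated mean and the Gini coefficient\<close>

text \<open>The kernel \<open>min w x\<close> is the Green's function of minus the second derivative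
  on the half-line, with value 0 at the origin and slope 0 at infinity.\<close>

definition truncated_mean :: "(real \<Rightarrow> real) \<Rightarrow> real \<Rightarrow> real"
  where "truncated_mean f w = (\<integral>x. min w x * f x \<partial>half_line)"

lemma integrable_truncated_mean:
  assumes "wealth_density f" "0 < w"
  shows "integrable half_line (\<lambda>x. min w x * f x)"
  using assms wealth_densityD(2)[OF assms(1)]
  by (intro integrable_bounded_mult[where C = w] AE_half_lineI) auto

text \<open>Unit mass gives the bound \<open>w\<close>, the unit first moment gives the bound 1.
  These are the two kinds of bounds that \<open>eq_0_if_second_differences_0\<close> asks
  for.\<close>

lemma truncated_mean_bounds:
  assumes f: "wealth_density f" and w: "0 < w"
  shows "0 \<le> truncated_mean f w" "truncated_mean f w \<le> w" "truncated_mean f w \<le> 1"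
proof -
  note fD = wealth_densityD[OF f] and int = integrable_truncated_mean[OF f w]
  have nonneg: "AE x in half_line. 0 < x \<and> 0 \<le> f x"
    using fD(1) by (auto intro: AE_half_lineI)
  have "AE x in half_line. 0 \<le> min w x * f x"
    using nonneg by eventually_elim (use w in auto)
  then show "0 \<le> truncated_mean f w"
    unfolding truncated_mean_def by (rule integral_nonneg_AE)
  have "AE x in half_line. min w x * f x \<le> w * f x"
    using nonneg by eventually_elim (auto intro: mult_right_mono)
  then have "truncated_mean f w \<le> (\<integral>x. w * f x \<partial>half_line)"
    unfolding truncated_mean_def using int fD by (intro integral_mono_AE) auto
  then show "truncated_mean f w \<le> w" using fD by simp
  have "AE x in half_line. min w x * f x \<le> x * f x"
    using nonneg by eventually_elim (auto intro: mult_right_mono)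
  then have "truncated_mean f w \<le> (\<integral>x. x * f x \<partial>half_line)"
    unfolding truncated_mean_def using int fD by (intro integral_mono_AE) auto
  then show "truncated_mean f w \<le> 1" using fD by simp
qed

lemma measurable_truncated_mean [measurable]:
  assumes [measurable]: "f \<in> borel_measurable half_line"
  shows "truncated_mean f \<in> borel_measurable half_line"
proof -
  interpret sigma_finite_measure half_line by (rule sigma_finite_half_line)
  show ?thesis unfolding truncated_mean_def by measurable
qed

lemma gini_eq_truncated_mean: "gini f = 1 - (\<integral>w. truncated_mean f w * f w \<partial>half_line)"
proof -
  have "(\<integral>x. min w x * f w * f x \<partial>half_line) = truncated_mean f w * f w" for w
  proof -
    have "(\<lambda>x. min w x * f w * f x) = (\<lambda>x. f w * (min w x * f x))" by (auto simp: ac_simps)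
    then show ?thesis by (simp add: truncated_mean_def mult.commute)
  qed
  then show ?thesis by (simp add: gini_def)
qed

text \<open>Fubini and the symmetry of \<open>min\<close>. It makes the mixed terms cancel when the
  Gini coefficients at two times are subtracted.\<close>

lemma integral_truncated_mean_commute:
  assumes f: "wealth_density f" and g: "wealth_density g"
  shows "(\<integral>w. truncated_mean f w * g w \<partial>half_line) = (\<integral>w. truncated_mean g w * f w \<partial>half_line)"
proof -
  note fD = wealth_densityD[OF f] and gD = wealth_densityD[OF g]
  note [measurable] = fD(6) gD(6)
  interpret pair_sigma_finite half_line half_line
    by (intro pair_sigma_finite.intro sigma_finite_half_line)
  let ?k = "\<lambda>w x. min w x * f x * g w"
  have norm: "(\<integral>x. norm (?k w x) \<partial>half_line) = truncated_mean f w * \<bar>g w\<bar>" if "0 < w" for w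
  proof -
    have "AE x in half_line. 0 < x \<and> 0 \<le> f x"
      using fD(1) by (auto intro: AE_half_lineI)
    then have "AE x in half_line. norm (?k w x) = min w x * f x * \<bar>g w\<bar>"
      by eventually_elim (use that in \<open>auto simp: abs_mult\<close>)
    then have "(\<integral>x. norm (?k w x) \<partial>half_line) = (\<integral>x. min w x * f x * \<bar>g w\<bar> \<partial>half_line)"
      by (intro integral_cong_AE) measurable
    then show ?thesis by (simp add: truncated_mean_def)
  qed
  have "integrable (half_line \<Otimes>\<^sub>M half_line) (case_prod ?k)"
  proof (rule Fubini_integrable)
    show "case_prod ?k \<in> borel_measurable (half_line \<Otimes>\<^sub>M half_line)" by measurable
    have "integrable half_line (\<lambda>w. truncated_mean f w * \<bar>g w\<bar>)"
      using gD truncated_mean_bounds[OF f]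
      by (intro integrable_bounded_mult[where C = 1] AE_half_lineI) auto
    then show "integrable half_line (\<lambda>w. \<integral>x. norm (case (w, x) of (w, x) \<Rightarrow> ?k w x) \<partial>half_line)"
      by (rule Bochner_Integration.integrable_cong_AE_imp)
        (auto intro!: AE_half_lineI simp: norm[symmetric])
    show "AE w in half_line. integrable half_line (\<lambda>x. case (w, x) of (w, x) \<Rightarrow> ?k w x)"
      using integrable_truncated_mean[OF f] by (intro AE_half_lineI) simp
  qed
  then have "(\<integral>x. (\<integral>w. ?k w x \<partial>half_line) \<partial>half_line) = (\<integral>w. (\<integral>x. ?k w x \<partial>half_line) \<partial>half_line)"
    by (rule Fubini_integral)
  moreover have "(\<integral>x. ?k w x \<partial>half_line) = truncated_mean f w * g w" for w
    by (simp add: truncated_mean_def)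
  moreover have "(\<integral>w. ?k w x \<partial>half_line) = truncated_mean g x * f x" for x
  proof -
    have "(\<lambda>w. ?k w x) = (\<lambda>w. f x * (min x w * g w))" by (auto simp: ac_simps min.commute)
    then show ?thesis by (simp add: truncated_mean_def mult.commute)
  qed
  ultimately show ?thesis by (simp only:)
qed

section \<open>The kernel \<open>kappa\<close> and the diffusion coefficient\<close>

text \<open>A positive number exceeds its square exactly below 1, so the case distinction selects
  the smaller value. This form exhibits continuity across the threshold and the comparison with
  \<open>min\<close>.\<close>

lemma kappa_eq_min:
  assumes "0 < w" "0 < x"
  shows "kappa w x = min ((min w x)\<^sup>2) (min w x)"
proof -
  have "m\<^sup>2 \<le> m" if "0 < m" "m < 1" for m :: real
    using that by (simp add: power2_eq_square mult_left_le_one_le)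
  moreover have "m \<le> m\<^sup>2" if "1 \<le> m" for m :: real
    using that by (simp add: power2_eq_square)
  ultimately show ?thesis
    using assms unfolding kappa_def by (smt (verit) min_def)
qed

lemma kappa_bounds:
  assumes "0 < w" "0 < x"
  shows "0 < kappa w x" "kappa w x \<le> min w x"
  using assms by (auto simp: kappa_eq_min)

lemma measurable_kappa [measurable]: "kappa w \<in> borel_measurable half_line"
  unfolding kappa_def by measurable

lemma integrable_kappa_mult:
  assumes "wealth_density f" "0 < w"
  shows "integrable half_line (\<lambda>x. kappa w x * f x)"
proof (intro integrable_bounded_mult[where C = w] AE_half_lineI)
  show "\<bar>kappa w x\<bar> \<le> w" if "0 < x" for x
    using kappa_bounds[OF \<open>0 < w\<close> that] by auto
qed (use wealth_densityD(2)[OF assms(1)] in auto)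

text \<open>A strictly positive kernel is integrated against a nonnegative density of mass 1.
  Strictness permits division by the coefficient in \<open>continuous_on_rho\<close>.\<close>

lemma diffusion_pos:
  assumes f: "wealth_density f" and "0 < w" "0 < \<gamma>"
  shows "0 < diffusion \<gamma> f w"
proof -
  note fD = wealth_densityD[OF f]
  have nonneg: "AE x in half_line. 0 < x \<and> 0 \<le> f x"
    using fD(1) by (auto intro: AE_half_lineI)
  have nonneg': "AE x in half_line. 0 \<le> kappa w x * f x"
    using nonneg by eventually_elim (use kappa_bounds \<open>0 < w\<close> in \<open>auto simp: less_imp_le\<close>)
  have "(\<integral>x. kappa w x * f x \<partial>half_line) \<noteq> 0"
  proof
    assume "(\<integral>x. kappa w x * f x \<partial>half_line) = 0"
    then have "AE x in half_line. kappa w x * f x = 0"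
      using integral_nonneg_eq_0_iff_AE[OF integrable_kappa_mult[OF f \<open>0 < w\<close>] nonneg'] by simp
    then have "AE x in half_line. f x = 0"
      using nonneg by eventually_elim (use kappa_bounds(1)[OF \<open>0 < w\<close>] in force)
    then have "(\<integral>x. f x \<partial>half_line) = (\<integral>x. 0 \<partial>half_line)"
      using fD by (intro integral_cong_AE) auto
    then show False using fD by simp
  qed
  then show ?thesis
    using integral_nonneg_AE[OF nonneg'] \<open>0 < \<gamma>\<close> by (simp add: diffusion_def)
qed

lemma diffusion_le_truncated_mean:
  assumes f: "wealth_density f" and "0 < w" "0 < \<gamma>"
  shows "diffusion \<gamma> f w \<le> \<gamma> / 2 * truncated_mean f w"
proof -
  have "AE x in half_line. 0 < x \<and> 0 \<le> f x"
    using wealth_densityD(1)[OF f] by (auto intro: AE_half_lineI)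
  then have "AE x in half_line. kappa w x * f x \<le> min w x * f x"
    by eventually_elim (use kappa_bounds(2) \<open>0 < w\<close> in \<open>auto intro: mult_right_mono\<close>)
  then have "(\<integral>x. kappa w x * f x \<partial>half_line) \<le> truncated_mean f w"
    unfolding truncated_mean_def
    by (intro integral_mono_AE integrable_kappa_mult integrable_truncated_mean f \<open>0 < w\<close>)
  then show ?thesis using \<open>0 < \<gamma>\<close> by (simp add: diffusion_def)
qed

text \<open>Density and wealth vary simultaneously, so that continuity in \<open>w\<close> at a
  fixed time and continuity in time at a fixed \<open>w\<close> are both instances.\<close>

lemma tendsto_diffusion:
  fixes w :: "nat \<Rightarrow> real"
  assumes f: "\<And>n. wealth_density (f n)" "wealth_density f'"
    and lim: "\<And>x. 0 < x \<Longrightarrow> (\<lambda>n. f n x) \<longlonglongrightarrow> f' x"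
    and w: "\<And>n. 0 < w n" "0 < w'" "w \<longlonglongrightarrow> w'"
  shows "(\<lambda>n. diffusion \<gamma> (f n) (w n)) \<longlonglongrightarrow> diffusion \<gamma> f' w'"
proof -
  obtain C where C: "\<bar>w n\<bar> \<le> C" for n
    using convergent_imp_Bseq[OF convergentI[OF w(3)]] by (auto simp: Bseq_def)
  have "(\<lambda>n. \<integral>x. kappa (w n) x * f n x \<partial>half_line) \<longlonglongrightarrow> (\<integral>x. kappa w' x * f' x \<partial>half_line)"
  proof (rule tendsto_integral_mult_density[where C = C])
    fix x :: real assume x: "0 < x"
    show "\<bar>kappa (w n) x\<bar> \<le> C" for n
      using kappa_bounds[OF w(1) x, of n] C[of n] by auto
    have "(\<lambda>n. min ((min (w n) x)\<^sup>2) (min (w n) x)) \<longlonglongrightarrow> min ((min w' x)\<^sup>2) (min w' x)"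
      by (intro tendsto_intros w)
    then show "(\<lambda>n. kappa (w n) x) \<longlonglongrightarrow> kappa w' x"
      using w x by (simp add: kappa_eq_min)
  qed (use f lim in auto)
  then show ?thesis unfolding diffusion_def by (intro tendsto_intros)
qed

lemma AE_abs_le_if_Linf_norm_le:
  assumes "Linf_norm f \<le> ereal K"
  shows "AE x in half_line. \<bar>f x\<bar> \<le> K"
proof -
  have "AE x in half_line. ereal \<bar>f x\<bar> \<le> Linf_norm f"
    unfolding Linf_norm_def by (rule esssup_AE)
  then show ?thesis
    by eventually_elim (metis assms ereal_less_eq(3) order_trans)
qed

section \<open>Evolution of the truncated mean along a solution\<close>

text \<open>The witnesses for the derivatives are fixed as parameters. The bound in
  \<open>AE_bounded\<close> is uniform up to each \<open>r < s\<close> but may blow up as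
  \<open>r\<close> approaches \<open>s\<close>.\<close>

locale yard_sale =
  fixes \<gamma> s :: real and \<rho> \<rho>' J :: "real \<Rightarrow> real \<Rightarrow> real"
  assumes gamma_pos: "0 < \<gamma>"
    and density: "\<And>t. t \<in> {0<..<s} \<Longrightarrow> wealth_density (\<lambda>w. \<rho> w t)"
    and continuous_time_deriv: "continuous_on ({0<..} \<times> {0<..<s}) (\<lambda>(w, t). \<rho>' w t)"
    and time_deriv: "\<And>w t. 0 < w \<Longrightarrow> t \<in> {0<..<s} \<Longrightarrow>
      ((\<lambda>\<tau>. \<rho> w \<tau>) has_real_derivative \<rho>' w t) (at t)"
    and flux_deriv: "\<And>w t. 0 < w \<Longrightarrow> t \<in> {0<..<s} \<Longrightarrow>
      ((\<lambda>v. diffusion \<gamma> (\<lambda>x. \<rho> x t) v * \<rho> v t) has_real_derivative J w t) (at w)"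
    and flux_deriv2: "\<And>w t. 0 < w \<Longrightarrow> t \<in> {0<..<s} \<Longrightarrow>
      ((\<lambda>v. J v t) has_real_derivative \<rho>' w t) (at w)"
    and AE_bounded: "\<And>r. r \<in> {0<..<s} \<Longrightarrow> \<exists>K. \<forall>t\<in>{0<..r}. AE w in half_line. \<bar>\<rho> w t\<bar> \<le> K"
begin

definition M :: "real \<Rightarrow> real \<Rightarrow> real" where "M w t = truncated_mean (\<lambda>x. \<rho> x t) w"

definition P :: "real \<Rightarrow> real \<Rightarrow> real" where "P w t = diffusion \<gamma> (\<lambda>x. \<rho> x t) w * \<rho> w t"

text \<open>Regularity in \<open>w\<close> is given only for the product of coefficient and density.
  The product is differentiable, the coefficient continuous and positive, so the quotient is
  continuous.\<close>

lemma continuous_on_rho: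
  assumes t: "t \<in> {0<..<s}"
  shows "continuous_on {0<..} (\<lambda>w. \<rho> w t)"
proof -
  let ?D = "diffusion \<gamma> (\<lambda>x. \<rho> x t)"
  have pos: "0 < ?D w" if "0 < w" for w
    using diffusion_pos[OF density[OF t] that gamma_pos] .
  have "(?D \<longlongrightarrow> ?D w) (at w within {0<..})" if "0 < w" for w
    unfolding tendsto_at_iff_sequentially comp_def
    using that density[OF t] by (auto intro!: tendsto_diffusion)
  then have "continuous_on {0<..} ?D" by (simp add: continuous_on_def)
  moreover have "continuous_on {0<..} (\<lambda>w. ?D w * \<rho> w t)"
    using flux_deriv[OF _ t] by (intro continuous_at_imp_continuous_on ballI DERIV_isCont) auto
  ultimately have "continuous_on {0<..} (\<lambda>w. ?D w * \<rho> w t / ?D w)"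
    using pos by (intro continuous_on_divide) (auto simp: less_imp_neq[symmetric])
  then show ?thesis
    by (rule continuous_on_eq) (use pos in \<open>auto simp: less_imp_neq[symmetric]\<close>)
qed

lemma abs_rho_le:
  assumes "t \<in> {0<..<s}" "AE w in half_line. \<bar>\<rho> w t\<bar> \<le> K" "0 < w"
  shows "\<bar>\<rho> w t\<bar> \<le> K"
  using AE_lborel_le_imp_le[OF assms(2) _ continuous_on_rabs[OF continuous_on_rho[OF assms(1)]]] assms(3)
  by simp

text \<open>Since \<open>kappa\<close> is at most \<open>min\<close>, the coefficient is at most
  \<open>\<gamma> / 2\<close> times \<open>M\<close>. Keeping the factor \<open>M\<close> provides
  both the decay of \<open>P\<close> near 0 and the final inequality.\<close>

lemma abs_P_le:
  assumes "t \<in> {0<..<s}" "AE w in half_line. \<bar>\<rho> w t\<bar> \<le> K" "0 < w"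
  shows "\<bar>P w t\<bar> \<le> \<gamma> / 2 * K * M w t"
proof -
  have "0 \<le> K" using abs_rho_le[OF assms] by simp
  have "\<bar>P w t\<bar> \<le> (\<gamma> / 2 * M w t) * K"
    unfolding P_def M_def abs_mult
    using diffusion_pos[OF density[OF assms(1)] \<open>0 < w\<close> gamma_pos]
      diffusion_le_truncated_mean[OF density[OF assms(1)] \<open>0 < w\<close> gamma_pos]
    by (intro mult_mono abs_rho_le assms) auto
  then show ?thesis by (simp add: ac_simps)
qed

text \<open>Pointwise continuity of \<open>\<rho>\<close> in time passes to the nonlocal coefficient
  by \<open>tendsto_diffusion\<close>. It is what allows differentiating the time integral of
  \<open>P\<close>.\<close>

lemma continuous_on_P:
  assumes "0 < w"
  shows "continuous_on {0<..<s} (P w)"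
proof -
  have rho: "continuous_on {0<..<s} (\<rho> x)" if "0 < x" for x
    using time_deriv[OF that] by (intro continuous_at_imp_continuous_on ballI DERIV_isCont) auto
  have "((\<lambda>\<tau>. diffusion \<gamma> (\<lambda>x. \<rho> x \<tau>) w) \<longlongrightarrow> diffusion \<gamma> (\<lambda>x. \<rho> x t) w) (at t within {0<..<s})"
    if t: "t \<in> {0<..<s}" for t
    unfolding tendsto_at_iff_sequentially comp_def
  proof (intro allI impI tendsto_diffusion tendsto_const assms)
    fix X x assume "\<forall>i. X i \<in> {0<..<s} - {t}" "X \<longlonglongrightarrow> t" "0 < (x::real)"
    then show "(\<lambda>n. \<rho> x (X n)) \<longlonglongrightarrow> \<rho> x t"
      using continuous_on_tendsto_compose[OF rho[OF \<open>0 < x\<close>] \<open>X \<longlonglongrightarrow> t\<close> t] by auto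
  qed (use density t in auto)
  then have "continuous_on {0<..<s} (\<lambda>\<tau>. diffusion \<gamma> (\<lambda>x. \<rho> x \<tau>) w)"
    by (simp add: continuous_on_def)
  then show ?thesis
    unfolding P_def using rho[OF assms] by (intro continuous_intros)
qed

text \<open>The tent from \<open>second_difference_min\<close> is supported in an interval that
  \<open>h < w\<close> keeps compact inside the half-line. There \<open>\<rho>\<close> is
  continuous, and the Lebesgue integral can be rewritten as the gauge integral used by the Leibniz
  rule.\<close>

lemma second_difference_M:
  assumes "0 < h" "h < w" and t: "t \<in> {0<..<s}"
  shows "M (w + h) t - 2 * M w t + M (w - h) t =
    - integral {w - h..w + h} (\<lambda>x. (h - \<bar>x - w\<bar>) * \<rho> x t)"
proof -
  note int = integrable_truncated_mean[OF density[OF t]]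
  have "M (w + h) t - 2 * M w t + M (w - h) t =
      (\<integral>x. min (w + h) x * \<rho> x t - 2 * (min w x * \<rho> x t) + min (w - h) x * \<rho> x t \<partial>half_line)"
    unfolding M_def truncated_mean_def
    using int[of "w + h"] int[of w] int[of "w - h"] assms by simp
  also have "\<dots> = (\<integral>x. (min (w + h) x - 2 * min w x + min (w - h) x) * \<rho> x t \<partial>half_line)"
    by (simp add: algebra_simps)
  also have "\<dots> = (\<integral>x. - (max 0 (h - \<bar>x - w\<bar>) * \<rho> x t) \<partial>half_line)"
    using assms by (simp add: second_difference_min)
  also have "\<dots> = - (\<integral>x. max 0 (h - \<bar>x - w\<bar>) * \<rho> x t \<partial>half_line)"
    by simp
  also have "(\<integral>x. max 0 (h - \<bar>x - w\<bar>) * \<rho> x t \<partial>half_line) =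
      (LINT x : {w - h..w + h} | lborel. (h - \<bar>x - w\<bar>) * \<rho> x t)"
    unfolding set_lebesgue_integral_def
    using assms by (subst integral_restrict_space)
      (auto intro!: Bochner_Integration.integral_cong split: split_indicator)
  also have "\<dots> = integral {w - h..w + h} (\<lambda>x. (h - \<bar>x - w\<bar>) * \<rho> x t)"
    using assms by (intro set_borel_integral_eq_integral borel_integrable_atLeastAtMost'
        continuous_intros continuous_on_subset[OF continuous_on_rho[OF t]]) auto
  finally show ?thesis .
qed

text \<open>On the compact support of the tent, joint continuity of \<open>\<rho>'\<close> justifies
  differentiation under the integral. As \<open>\<rho>'\<close> is also the second
  \<open>w\<close>-derivative of \<open>P\<close>, the Peano kernel formula evaluates the
  result.\<close>

lemma second_difference_M_deriv:
  assumes "0 < h" "h < w" and t: "t \<in> {0<..<s}"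
  shows "((\<lambda>t. M (w + h) t - 2 * M w t + M (w - h) t) has_real_derivative
    - (P (w + h) t - 2 * P w t + P (w - h) t)) (at t)"
proof -
  have "((\<lambda>\<tau>. integral (cbox (w - h) (w + h)) (\<lambda>x. (h - \<bar>x - w\<bar>) * \<rho> x \<tau>)) has_real_derivative
      integral (cbox (w - h) (w + h)) (\<lambda>x. (h - \<bar>x - w\<bar>) * \<rho>' x t)) (at t within {0<..<s})"
  proof (rule leibniz_rule_field_derivative)
    show "((\<lambda>\<tau>. (h - \<bar>x - w\<bar>) * \<rho> x \<tau>) has_real_derivative (h - \<bar>x - w\<bar>) * \<rho>' x \<tau>) (at \<tau> within {0<..<s})"
      if "\<tau> \<in> {0<..<s}" "x \<in> cbox (w - h) (w + h)" for \<tau> x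
      using that assms by (intro DERIV_cmult has_field_derivative_at_within[OF time_deriv]) auto
    show "(\<lambda>x. (h - \<bar>x - w\<bar>) * \<rho> x \<tau>) integrable_on cbox (w - h) (w + h)" if "\<tau> \<in> {0<..<s}" for \<tau>
      using assms by (intro integrable_continuous continuous_intros
          continuous_on_subset[OF continuous_on_rho[OF that]]) auto
    have "continuous_on ({0<..<s} \<times> cbox (w - h) (w + h)) ((\<lambda>(x, t). \<rho>' x t) \<circ> prod.swap)"
      using assms by (intro continuous_on_compose continuous_on_swap
          continuous_on_subset[OF continuous_time_deriv]) auto
    then show "continuous_on ({0<..<s} \<times> cbox (w - h) (w + h)) (\<lambda>(\<tau>, x). (h - \<bar>x - w\<bar>) * \<rho>' x \<tau>)"
      by (auto simp: case_prod_unfold comp_def intro!: continuous_intros)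
  qed (use t in auto)
  then have "((\<lambda>\<tau>. - integral {w - h..w + h} (\<lambda>x. (h - \<bar>x - w\<bar>) * \<rho> x \<tau>)) has_real_derivative
      - integral {w - h..w + h} (\<lambda>x. (h - \<bar>x - w\<bar>) * \<rho>' x t)) (at t)"
    using t by (auto simp: at_within_open[of t "{0<..<s}"] intro: DERIV_minus)
  moreover have "integral {w - h..w + h} (\<lambda>x. (h - \<bar>x - w\<bar>) * \<rho>' x t) =
      P (w + h) t - 2 * P w t + P (w - h) t"
    unfolding P_def
    using assms by (intro integral_unique has_integral_second_difference[where J = "\<lambda>x. J x t"]
        flux_deriv flux_deriv2) auto
  ultimately show ?thesis
    using t
    by (auto simp: second_difference_M[OF assms(1,2)] elim!: has_field_derivative_transform_within_open[of _ _ _ "{0<..<s}"])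
qed

text \<open>The previous lemma fixes the time derivative of \<open>M\<close> only modulo affine
  functions of \<open>w\<close>. Working with the equation integrated in time avoids presupposing
  that \<open>M\<close> is differentiable; the affine ambiguity is then removed by
  \<open>eq_0_if_second_differences_0\<close>.\<close>

lemma M_deriv:
  assumes "0 < w" and t: "t \<in> {0<..<s}"
  shows "(M w has_real_derivative - P w t) (at t)"
proof -
  define a b where "a = t / 2" and "b = (t + s) / 2"
  have ab: "a < t" "t < b" "{a..b} \<subseteq> {0<..<s}" using t by (auto simp: a_def b_def)
  obtain K where K: "\<And>\<tau>. \<tau> \<in> {0<..b} \<Longrightarrow> AE w in half_line. \<bar>\<rho> w \<tau>\<bar> \<le> K"
    using AE_bounded[of b] ab t by (force simp: b_def)
  have "0 \<le> K" using abs_rho_le[OF t K \<open>0 < w\<close>] t ab by fastforce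
  \<comment> \<open>\<open>H\<close> is the defect in the time-integrated equation from
    \<open>a\<close> to \<open>\<tau>\<close>.\<close>
  define H where "H \<tau> v = M v \<tau> - M v a + integral {a..\<tau>} (P v)" for \<tau> v
  have cont: "continuous_on {a..b} (P v)" if "0 < v" for v
    using continuous_on_P[OF that] ab(3) by (rule continuous_on_subset)
  have H0: "H \<tau> v = 0" if \<tau>: "\<tau> \<in> {a..b}" and "0 < v" for \<tau> v
  proof (rule eq_0_if_second_differences_0[where H = "H \<tau>"])
    fix v h :: real assume h: "0 < h" "h < v"
    define Q where "Q \<sigma> = M (v + h) \<sigma> - 2 * M v \<sigma> + M (v - h) \<sigma>" for \<sigma>
    have "((\<lambda>\<sigma>. Q \<sigma> - Q a
          + (integral {a..\<sigma>} (P (v + h)) - 2 * integral {a..\<sigma>} (P v) + integral {a..\<sigma>} (P (v - h))))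
        has_real_derivative 0) (at \<sigma> within {a..b})" if "\<sigma> \<in> {a..b}" for \<sigma>
    proof -
      have "(Q has_real_derivative - (P (v + h) \<sigma> - 2 * P v \<sigma> + P (v - h) \<sigma>)) (at \<sigma> within {a..b})"
        unfolding Q_def using that ab h
        by (intro has_field_derivative_at_within[OF second_difference_M_deriv]) auto
      then show ?thesis
        using that h
        by (auto intro!: derivative_eq_intros integral_has_real_derivative cont)
    qed
    from has_field_derivative_zero_constant[OF convex_real_interval(5) this]
    obtain c where c: "\<And>\<sigma>. \<sigma> \<in> {a..b} \<Longrightarrow> H \<sigma> (v + h) - 2 * H \<sigma> v + H \<sigma> (v - h) = c"
      by (auto simp: H_def Q_def algebra_simps)
    \<comment> \<open>The constant \<open>c\<close> is read off at the initial time
      \<open>a\<close>, where the defect is 0.\<close>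
    show "H \<tau> (v + h) - 2 * H \<tau> v + H \<tau> (v - h) = 0"
      using c[OF \<tau>] c[of a] ab by (simp add: H_def)
  next
    \<comment> \<open>Taking \<open>m = 1\<close> and \<open>m = v\<close> yields the uniform and
      the linear bound with the same constant.\<close>
    have bound: "\<bar>H \<tau> v\<bar> \<le> (1 + \<gamma> / 2 * K * (\<tau> - a)) * m"
      if "0 < v" and m: "\<And>\<sigma>. \<sigma> \<in> {a..b} \<Longrightarrow> M v \<sigma> \<le> m" for v m
    proof -
      have nonneg: "0 \<le> M v \<sigma>" if "\<sigma> \<in> {a..b}" for \<sigma>
        unfolding M_def using that ab \<open>0 < v\<close> by (intro truncated_mean_bounds density) auto
      have "norm (integral {a..\<tau>} (P v)) \<le> \<gamma> / 2 * K * m * (\<tau> - a)"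
      proof (rule integral_bound)
        fix \<sigma> assume \<sigma>: "\<sigma> \<in> {a..\<tau>}"
        have "\<bar>P v \<sigma>\<bar> \<le> \<gamma> / 2 * K * M v \<sigma>"
          using \<sigma> \<tau> ab \<open>0 < v\<close> t by (intro abs_P_le K) (auto simp: a_def b_def)
        also have "\<dots> \<le> \<gamma> / 2 * K * m"
          using \<sigma> \<tau> gamma_pos \<open>0 \<le> K\<close> by (intro mult_left_mono m) auto
        finally show "norm (P v \<sigma>) \<le> \<gamma> / 2 * K * m" by simp
      qed (use \<tau> continuous_on_subset[OF cont[OF \<open>0 < v\<close>]] in auto)
      moreover have "\<bar>M v \<tau> - M v a\<bar> \<le> m"
        using nonneg[of a] nonneg[OF \<tau>] m[of a] m[OF \<tau>] ab by auto
      moreover have "\<bar>H \<tau> v\<bar> \<le> \<bar>M v \<tau> - M v a\<bar> + norm (integral {a..\<tau>} (P v))"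
        by (simp add: H_def)
      ultimately have "\<bar>H \<tau> v\<bar> \<le> m + \<gamma> / 2 * K * m * (\<tau> - a)" by linarith
      then show ?thesis by (simp add: algebra_simps)
    qed
    fix v :: real assume v: "0 < v"
    have "M v \<sigma> \<le> 1" "M v \<sigma> \<le> v" if "\<sigma> \<in> {a..b}" for \<sigma>
      unfolding M_def using that ab v by (intro truncated_mean_bounds density; auto)+
    then show "\<bar>H \<tau> v\<bar> \<le> 1 + \<gamma> / 2 * K * (\<tau> - a)" "\<bar>H \<tau> v\<bar> \<le> (1 + \<gamma> / 2 * K * (\<tau> - a)) * v"
      using bound[OF v, of 1] bound[OF v, of v] by auto
  qed (rule \<open>0 < v\<close>)
  have deriv: "((\<lambda>\<tau>. M w a - integral {a..\<tau>} (P w)) has_real_derivative - P w t) (at t within {a..b})"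
    using ab by (auto intro!: derivative_eq_intros integral_has_real_derivative cont \<open>0 < w\<close>)
  have eq: "M w a - integral {a..\<tau>} (P w) = M w \<tau>" if "\<tau> \<in> {a..b}" for \<tau>
    using H0[OF that \<open>0 < w\<close>] by (simp add: H_def)
  have "(M w has_real_derivative - P w t) (at t within {a..b})"
    using ab(1,2) by (intro has_field_derivative_transform_within[OF deriv zero_less_one _ eq]) auto
  then show ?thesis using ab by (simp add: at_within_Icc_at)
qed

section \<open>The derivative of the Gini coefficient and its bound\<close>

text \<open>By symmetry of \<open>min\<close>, the difference quotient of the Gini coefficient is
  minus the integral of the difference quotient of \<open>M\<close> against the sum of the densities
  at both times. So only \<open>M\<close> is differentiated in time under the integral, while
  \<open>\<rho>\<close> merely has to converge.\<close>

lemma gini_deriv: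
  assumes t: "t \<in> {0<..<s}"
  shows "((\<lambda>\<tau>. gini (\<lambda>w. \<rho> w \<tau>)) has_real_derivative 2 * (\<integral>w. P w t * \<rho> w t \<partial>half_line)) (at t)"
proof -
  define b where "b = (t + s) / 2"
  define S where "S = {0<..<b}"
  have S: "t \<in> S" "open S" "convex S" "S \<subseteq> {0<..<s}" using t by (auto simp: S_def b_def)
  obtain K where K: "\<And>\<tau>. \<tau> \<in> {0<..b} \<Longrightarrow> AE w in half_line. \<bar>\<rho> w \<tau>\<bar> \<le> K"
    using AE_bounded[of b] t by (force simp: b_def)
  have "0 \<le> K" using abs_rho_le[OF t K, of 1] S by (fastforce simp: S_def)
  \<comment> \<open>The mean value inequality with \<open>M \<le> 1\<close>; a constant independent
    of \<open>w\<close> bounds the difference quotients \<open>q n\<close> uniformly.\<close>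
  have lipschitz: "\<bar>M w \<tau> - M w t\<bar> \<le> \<gamma> / 2 * K * \<bar>\<tau> - t\<bar>" if "0 < w" "\<tau> \<in> S" for w \<tau>
  proof -
    have "\<bar>P w \<sigma>\<bar> \<le> \<gamma> / 2 * K" if "\<sigma> \<in> S" for \<sigma>
    proof -
      have "\<sigma> \<in> {0<..<s}" using that S by auto
      have "\<bar>P w \<sigma>\<bar> \<le> \<gamma> / 2 * K * M w \<sigma>"
        using that \<open>\<sigma> \<in> {0<..<s}\<close> \<open>0 < w\<close> by (intro abs_P_le K) (auto simp: S_def)
      also have "\<dots> \<le> \<gamma> / 2 * K * 1"
        unfolding M_def using gamma_pos \<open>0 \<le> K\<close> \<open>0 < w\<close> \<open>\<sigma> \<in> {0<..<s}\<close>
        by (intro mult_left_mono truncated_mean_bounds density) auto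
      finally show ?thesis by simp
    qed
    then have "norm (M w \<tau> - M w t) \<le> \<gamma> / 2 * K * norm (\<tau> - t)"
      using S that
      by (intro field_differentiable_bound[where f = "M w" and f' = "\<lambda>\<sigma>. - P w \<sigma>" and S = S]
          has_field_derivative_at_within[OF M_deriv]) auto
    then show ?thesis by simp
  qed
  let ?g = "\<lambda>\<tau>. gini (\<lambda>w. \<rho> w \<tau>)"
  have "((\<lambda>\<tau>. (?g \<tau> - ?g t) / (\<tau> - t)) \<longlongrightarrow> 2 * (\<integral>w. P w t * \<rho> w t \<partial>half_line)) (at t within S)"
    unfolding tendsto_at_iff_sequentially comp_def
  proof (intro allI impI)
    fix X assume X: "\<forall>i. X i \<in> S - {t}" "X \<longlonglongrightarrow> t"
    define q where "q n w = (M w (X n) - M w t) / (X n - t)" for n w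
    have dens: "wealth_density (\<lambda>w. \<rho> w (X n))" "wealth_density (\<lambda>w. \<rho> w t)" for n
      using X S by (auto intro!: density)
    note densD = wealth_densityD[OF dens(1)] wealth_densityD[OF dens(2)]
    have M_measurable: "(\<lambda>w. M w (X n)) \<in> borel_measurable half_line"
      "(\<lambda>w. M w t) \<in> borel_measurable half_line" for n
      unfolding M_def using densD by (auto intro: measurable_truncated_mean)
    have q_measurable: "q n \<in> borel_measurable half_line" for n
      unfolding q_def using M_measurable by measurable
    have q_bound: "\<bar>q n w\<bar> \<le> \<gamma> / 2 * K" if "0 < w" for n w
      using lipschitz[OF that, of "X n"] X
      by (auto simp: q_def divide_simps)
    have q_lim: "(\<lambda>n. q n w) \<longlonglongrightarrow> - P w t" if "0 < w" for w
    proof -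
      have "((\<lambda>\<tau>. (M w \<tau> - M w t) / (\<tau> - t)) \<longlongrightarrow> - P w t) (at t within S)"
        using has_field_derivative_at_within[OF M_deriv[OF that t]] by (simp add: has_field_derivative_iff)
      then show ?thesis
        using X unfolding tendsto_at_iff_sequentially comp_def q_def by blast
    qed
    have rho_lim: "(\<lambda>n. \<rho> w (X n)) \<longlonglongrightarrow> \<rho> w t" if "0 < w" for w
      using DERIV_isCont[OF time_deriv[OF that t]] X(2) by (rule isCont_tendsto_compose)
    \<comment> \<open>The first limit has the moving density at time \<open>X n\<close>, the second
      the constant sequence at time \<open>t\<close>.\<close>
    note lims = tendsto_integral_mult_density[OF dens rho_lim q_measurable q_bound q_lim]
      tendsto_integral_mult_density[OF dens(2) dens(2) tendsto_const q_measurable q_bound q_lim]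
    have "(\<lambda>n. - (\<integral>w. q n w * \<rho> w (X n) \<partial>half_line) - (\<integral>w. q n w * \<rho> w t \<partial>half_line)) \<longlonglongrightarrow>
       - (\<integral>w. - P w t * \<rho> w t \<partial>half_line) - (\<integral>w. - P w t * \<rho> w t \<partial>half_line)"
      by (intro tendsto_intros lims)
    moreover have "- (\<integral>w. q n w * \<rho> w (X n) \<partial>half_line) - (\<integral>w. q n w * \<rho> w t \<partial>half_line) =
      (?g (X n) - ?g t) / (X n - t)" for n
    proof -
      have M_int: "integrable half_line (\<lambda>w. M w \<tau> * f w)"
        if "\<tau> \<in> {t, X n}" "integrable half_line f" for \<tau> f
      proof (intro integrable_bounded_mult[where C = 1] AE_half_lineI)
        show "\<bar>M w \<tau>\<bar> \<le> 1" if "0 < w" for w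
          using truncated_mean_bounds[OF dens(1)[of n] that] truncated_mean_bounds[OF dens(2) that]
            \<open>\<tau> \<in> {t, X n}\<close> by (auto simp: M_def)
      qed (use that M_measurable in auto)
      have q_int: "(\<integral>w. q n w * f w \<partial>half_line) =
          ((\<integral>w. M w (X n) * f w \<partial>half_line) - (\<integral>w. M w t * f w \<partial>half_line)) / (X n - t)"
        if "integrable half_line f" for f
        using M_int[OF _ that] by (simp add: q_def left_diff_distrib)
      have "(\<integral>w. M w (X n) * \<rho> w t \<partial>half_line) = (\<integral>w. M w t * \<rho> w (X n) \<partial>half_line)"
        unfolding M_def by (intro integral_truncated_mean_commute dens)
      then show ?thesis
        using densD
        by (simp add: q_int gini_eq_truncated_mean M_def[symmetric] divide_simps)
    qed
    ultimately show "(\<lambda>n. (?g (X n) - ?g t) / (X n - t)) \<longlonglongrightarrow> 2 * (\<integral>w. P w t * \<rho> w t \<partial>half_line)"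
      by simp
  qed
  then show ?thesis
    using S by (simp add: has_field_derivative_iff at_within_open[of t S])
qed

text \<open>Integrate \<open>abs_P_le\<close> against \<open>\<rho>\<close>: the integral of
  \<open>M \<rho>\<close> is one minus the Gini coefficient, and the factor 2 absorbs the
  \<open>\<gamma> / 2\<close>.\<close>

lemma integral_P_rho_le:
  assumes t: "t \<in> {0<..<s}" and K: "AE w in half_line. \<bar>\<rho> w t\<bar> \<le> K"
  shows "2 * (\<integral>w. P w t * \<rho> w t \<partial>half_line) \<le> \<gamma> * K * (1 - gini (\<lambda>w. \<rho> w t))"
proof -
  note dens = density[OF t]
  note densD = wealth_densityD[OF dens]
  have "0 \<le> K" using abs_rho_le[OF t K, of 1] by simp
  have M_int: "integrable half_line (\<lambda>w. M w t * \<rho> w t)"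
    unfolding M_def using densD truncated_mean_bounds[OF dens]
    by (intro integrable_bounded_mult[where C = 1] AE_half_lineI) (auto intro: measurable_truncated_mean)
  have nonneg: "AE w in half_line. 0 < w \<and> 0 \<le> \<rho> w t"
    using densD(1) by (auto intro: AE_half_lineI)
  then have "AE w in half_line. P w t * \<rho> w t \<le> \<gamma> / 2 * K * (M w t * \<rho> w t)"
  proof eventually_elim
    case (elim w)
    then have "P w t \<le> \<gamma> / 2 * K * M w t" using abs_P_le[OF t K, of w] by simp
    then have "P w t * \<rho> w t \<le> (\<gamma> / 2 * K * M w t) * \<rho> w t"
      using elim by (intro mult_right_mono) auto
    then show ?case by (simp only: mult.assoc)
  qed
  \<comment> \<open>With a nonnegative majorant the comparison holds without integrability of the
    left side, whose integral would default to 0.\<close>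
  moreover have "AE w in half_line. 0 \<le> \<gamma> / 2 * K * (M w t * \<rho> w t)"
    using nonneg
    by eventually_elim (use gamma_pos \<open>0 \<le> K\<close> truncated_mean_bounds(1)[OF dens] in \<open>auto simp: M_def\<close>)
  ultimately have "(\<integral>w. P w t * \<rho> w t \<partial>half_line) \<le> (\<integral>w. \<gamma> / 2 * K * (M w t * \<rho> w t) \<partial>half_line)"
    using M_int by (intro integral_mono_AE') auto
  then show ?thesis
    by (simp add: gini_eq_truncated_mean M_def mult.assoc)
qed

end

theorem theorem4p3:
  fixes \<gamma> s :: real and \<rho> :: "real \<Rightarrow> real \<Rightarrow> real"
  assumes "0 < \<gamma>" and "\<gamma> < 1" and "0 < s"
    and "yard_sale_solution \<gamma> s \<rho>"
    and "Linf_norm (\<lambda>w. \<rho> w 0) < \<infinity>"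
    and "\<And>r. 0 < r \<Longrightarrow> r < s \<Longrightarrow> (SUP t\<in>{0..r}. Linf_norm (\<lambda>w. \<rho> w t)) < \<infinity>"
  shows "\<forall>t. 0 < t \<and> t < s \<longrightarrow>
    (\<lambda>\<tau>. gini (\<lambda>w. \<rho> w \<tau>)) field_differentiable (at t) \<and>
    deriv (\<lambda>\<tau>. gini (\<lambda>w. \<rho> w \<tau>)) t
      \<le> \<gamma> * real_of_ereal (Linf_norm (\<lambda>w. \<rho> w t)) * (1 - gini (\<lambda>w. \<rho> w t))"
proof -
  \<comment> \<open>An inequality, since \<open>real_of_ereal\<close> sends minus infinity to
    0.\<close>
  have le_real: "x \<le> ereal (real_of_ereal x)" if "x < \<infinity>" for x :: ereal
    using that by (cases x) auto
  have bounded: "AE w in half_line. \<bar>\<rho> w t\<bar> \<le> real_of_ereal (SUP t\<in>{0..r}. Linf_norm (\<lambda>w. \<rho> w t))"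
    if "0 < r" "r < s" "t \<in> {0<..r}" for r t
  proof (rule AE_abs_le_if_Linf_norm_le)
    have "Linf_norm (\<lambda>w. \<rho> w t) \<le> (SUP t\<in>{0..r}. Linf_norm (\<lambda>w. \<rho> w t))"
      using that by (intro SUP_upper) auto
    also have "\<dots> \<le> ereal (real_of_ereal \<dots>)"
      using that by (intro le_real assms)
    finally show "Linf_norm (\<lambda>w. \<rho> w t) \<le> ereal (real_of_ereal (SUP t\<in>{0..r}. Linf_norm (\<lambda>w. \<rho> w t)))" .
  qed
  obtain \<rho>' J where
    "continuous_on ({0<..} \<times> {0<..<s}) (\<lambda>(w, t). \<rho>' w t)"
    "\<forall>w>0. \<forall>t\<in>{0<..<s}.
      ((\<lambda>\<tau>. \<rho> w \<tau>) has_real_derivative \<rho>' w t) (at t) \<and>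
      ((\<lambda>v. diffusion \<gamma> (\<lambda>x. \<rho> x t) v * \<rho> v t) has_real_derivative J w t) (at w) \<and>
      ((\<lambda>v. J v t) has_real_derivative \<rho>' w t) (at w)"
    using assms(4) unfolding yard_sale_solution_def by blast
  moreover have "\<forall>t\<in>{0..<s}. wealth_density (\<lambda>w. \<rho> w t)"
    using assms(4) unfolding yard_sale_solution_def by blast
  moreover have "\<exists>K. \<forall>t\<in>{0<..r}. AE w in half_line. \<bar>\<rho> w t\<bar> \<le> K" if "r \<in> {0<..<s}" for r
    using that
    by (intro exI[of _ "real_of_ereal (SUP t\<in>{0..r}. Linf_norm (\<lambda>w. \<rho> w t))"] ballI bounded) auto
  ultimately interpret yard_sale \<gamma> s \<rho> \<rho>' J
    using assms(1) by unfold_locales auto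
  show ?thesis
  proof (intro allI impI)
    fix t assume "0 < t \<and> t < s"
    then have t: "t \<in> {0<..<s}" by simp
    \<comment> \<open>The supremum hypothesis at \<open>r = t\<close> makes the norm at time
      \<open>t\<close> less than infinity, so the norm itself can serve as \<open>K\<close>.\<close>
    have "Linf_norm (\<lambda>w. \<rho> w t) \<le> (SUP t\<in>{0..t}. Linf_norm (\<lambda>w. \<rho> w t))"
      using t by (intro SUP_upper) auto
    also have "\<dots> < \<infinity>" using t by (intro assms) auto
    finally have "AE w in half_line. \<bar>\<rho> w t\<bar> \<le> real_of_ereal (Linf_norm (\<lambda>w. \<rho> w t))"
      by (intro AE_abs_le_if_Linf_norm_le le_real)
    from integral_P_rho_le[OF t this] gini_deriv[OF t]
    show "(\<lambda>\<tau>. gini (\<lambda>w. \<rho> w \<tau>)) field_differentiable (at t) \<and>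
      deriv (\<lambda>\<tau>. gini (\<lambda>w. \<rho> w \<tau>)) t
        \<le> \<gamma> * real_of_ereal (Linf_norm (\<lambda>w. \<rho> w t)) * (1 - gini (\<lambda>w. \<rho> w t))"
      using DERIV_imp_deriv field_differentiable_def by metis
  qed
qed

end
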